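(* For each integer $k\ge4$, each $\underline q=(q_1,q_2)\in\mathbb{R}^2$ with \[ 0\le q_1\le 2F_{k-1}+2F_{k-3}\quad\text{and}\quad 0\le q_2\le\min\{q_1,2F_{k-1}\}, \] and each $j=1,2,3$, we have $P_j(q_1+4F_{k-2},\,q_2+2F_{k-2})=P_j(q_1,q_2)+2F_{k-2}$.
   Context: Fibonacci numbers: $F_{-1}=0$, $F_0=1$, $F_{i+2}=F_{i+1}+F_i$. Words: $E=\{a,b\}$, $E^*$ the monoid of finite words, $\epsilon$ the empty word, $|w|$ the length, $u\le w$ means $u$ is a prefix of $w$, $u<w$ means $u\le w$ and $u\ne w$. Let $w_1=a$, $w_2=ab$, $w_{i+2}=w_{i+1}w_i$, $w_\infty=\lim w_i$; prefixes of $w_\infty$ are words $v\le w_i$ for some $i$. Let $\mathcal{F}=\{\epsilon,w_1,w_2,\dots\}$. For a prefix $v$ of $w_\infty$: $\iota(v)=v$ if $v\in\mathcal{F}$; otherwise $w_i<v<w_{i+1}$ for some $i\ge3$ and $\iota(v)$ is the prefix of $w_\infty$ of length $|v|-2F_{i-2}$. Set $\alpha(v)=\lim_{k\to\infty}\iota^k(v)$ (eventually constant). For a prefix $v$ of $w_\infty$ let $P_v(q_1,q_2)=\max\{q_1-|v|,\,q_2-|\alpha(v)|,\,|v|\}$, $\mathcal{A}(v)=\{\underline q: P_v(\underline q)=q_1-|v|\}$, $\mathcal{C}(v)=\{\underline q: P_v(\underline q)=|v|\}$; note $\mathcal{A}(\epsilon)=\{(q_1,q_2): q_1\ge0,\ q_2\le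 q_1\}$. Let $\Phi:\mathbb{R}^3\to\mathbb{R}^3$ sort coordinates in non-decreasing order. For $\underline q\in\mathcal{A}(\epsilon)$ define $\underline P(\underline q)=(P_1(\underline q),P_2(\underline q),P_3(\underline q))=\Phi(q_1-|u|,\,q_2+|u|-|w|,\,|w|)$ where $u$ is the largest prefix of $w_\infty$ with $\underline q\in\mathcal{A}(u)$, and $w$ is the smallest prefix of $w_\infty$ with $u<w$ and $\underline q\in\mathcal{C}(w)$. *)

theory Defs
  imports "HOL-Analysis.Analysis" "HOL-Library.Sublist" "HOL-Number_Theory.Fib"
begin

text \<open>Shifted Fibonacci numbers with \<open>F 0 = F 1 = 1\<close>; the library's \<^const>\<open>fib\<close> has
  \<open>fib 0 = 0\<close> and \<open>fib 1 = 1\<close>, so that the usual convention \<open>F (-1) = 0\<close> corresponds to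
  \<open>fib 0\<close>.\<close>

definition fibF :: "nat \<Rightarrow> nat" where
  "fibF i = fib (Suc i)"

datatype letter = La | Lb

text \<open>The Fibonacci words are indexed from 1. The value at 0 is the one compatible with the
  recurrence; it is not a prefix of the infinite word and is excluded below.\<close>

fun fword :: "nat \<Rightarrow> letter list" where
  "fword 0 = [Lb]"
| "fword (Suc 0) = [La]"
| "fword (Suc (Suc i)) = fword (Suc i) @ fword i"

text \<open>Finite prefixes of the infinite Fibonacci word.\<close>

definition winf_prefix :: "letter list \<Rightarrow> bool" where
  "winf_prefix v \<longleftrightarrow> (\<exists>i\<ge>1. prefix v (fword i))"

definition FW :: "letter list set" where
  "FW = insert [] (fword ` {1..})"

text \<open>For a prefix \<open>v\<close> of the infinite word, its prefix of length \<open>n \<le> length v\<close> is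
  \<open>take n v\<close>. The functions \<open>iota\<close>, \<open>alpha\<close>, \<open>Pv\<close>, \<open>regA\<close>, \<open>regC\<close> are only meaningful for such \<open>v\<close>.\<close>

definition iota :: "letter list \<Rightarrow> letter list" where
  "iota v =
    (if v \<in> FW then v
     else (let i = (THE i. 3 \<le> i \<and> strict_prefix (fword i) v \<and> strict_prefix v (fword (Suc i)))
           in take (length v - 2 * fibF (i - 2)) v))"

definition alpha :: "letter list \<Rightarrow> letter list" where
  "alpha v = (THE u. \<forall>\<^sub>F k in sequentially. (iota ^^ k) v = u)"

definition Pv :: "letter list \<Rightarrow> real \<times> real \<Rightarrow> real" where
  "Pv v q = Max {fst q - real (length v), snd q - real (length (alpha v)), real (length v)}"

definition regA :: "letter list \<Rightarrow> (real \<times> real) set" where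
  "regA v = {q. Pv v q = fst q - real (length v)}"

definition regC :: "letter list \<Rightarrow> (real \<times> real) set" where
  "regC v = {q. Pv v q = real (length v)}"

definition Phi :: "real^3 \<Rightarrow> real^3" where
  "Phi x = vector (sort [x $ 1, x $ 2, x $ 3])"

text \<open>Largest and smallest refer to the prefix order, which is total on prefixes of the
  infinite word.\<close>

definition maxA :: "real \<times> real \<Rightarrow> letter list" where
  "maxA q = (THE u. winf_prefix u \<and> q \<in> regA u \<and>
     (\<forall>u'. winf_prefix u' \<and> q \<in> regA u' \<longrightarrow> prefix u' u))"

definition minC :: "real \<times> real \<Rightarrow> letter list" where
  "minC q = (THE w. winf_prefix w \<and> strict_prefix (maxA q) w \<and> q \<in> regC w \<and>
     (\<forall>w'. winf_prefix w' \<and> strict_prefix (maxA q) w' \<and> q \<in> regC w' \<longrightarrow> prefix w w'))"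

text \<open>Only meaningful for \<open>q \<in> regA []\<close>.\<close>

definition P :: "real \<times> real \<Rightarrow> real^3" where
  "P q = (let u = real (length (maxA q)); w = real (length (minC q))
          in Phi (vector [fst q - u, snd q + u - w, w]))"

end

theory Submission imports Defs
begin

text \<open>A prefix of the infinite word is determined by its length, so membership of \<open>q\<close> in
  \<open>\<A>(v)\<close> and \<open>\<C>(v)\<close> only involves \<open>n = |v|\<close> and \<open>|\<alpha>(v)|\<close>. Under the translation
  \<open>(q\<^sub>1, q\<^sub>2) \<mapsto> (q\<^sub>1 + 4 F\<^sub>k\<^sub>-\<^sub>2, q\<^sub>2 + 2 F\<^sub>k\<^sub>-\<^sub>2)\<close> and \<open>n \<mapsto> n + 2 F\<^sub>k\<^sub>-\<^sub>2\<close> the two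
  memberships are preserved: for most \<open>n\<close> the value of \<open>|\<alpha>|\<close> is the same at \<open>n\<close> and at
  \<open>n + 2 F\<^sub>k\<^sub>-\<^sub>2\<close>, and at the exceptional lengths both values are so large that the conditions
  on \<open>q\<^sub>2\<close> hold automatically. It suffices to compare \<open>\<A>\<close> up to length \<open>F\<^sub>k\<^sub>-\<^sub>1 + F\<^sub>k\<^sub>-\<^sub>3\<close>, the
  bound on \<open>q\<^sub>1 / 2\<close>, and \<open>\<C>\<close> up to length \<open>F\<^sub>k\<close>, where membership always
  holds. Hence \<open>u\<close> and \<open>w\<close> both grow by \<open>2 F\<^sub>k\<^sub>-\<^sub>2\<close>, and so
  does each of the three numbers that \<open>\<Phi>\<close> sorts.\<close>

section \<open>Shifted Fibonacci numbers\<close>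

lemma fibF_simps:
  "fibF 0 = 1" "fibF (Suc 0) = 1" "fibF (Suc (Suc i)) = fibF (Suc i) + fibF i"
  by (simp_all add: fibF_def)

lemma fibF_pos [simp]: "0 < fibF i"
  by (simp add: fibF_def fib_neq_0_nat)

lemma fibF_2: "fibF 2 = 2" and fibF_3: "fibF 3 = 3"
  by (simp_all add: fibF_def eval_nat_numeral)

lemma fibF_rec:
  "fibF (m + 2) = fibF (m + 1) + fibF m" "fibF (m + 3) = fibF (m + 2) + fibF (m + 1)"
  "fibF (m + 4) = fibF (m + 3) + fibF (m + 2)" "fibF (m + 5) = fibF (m + 4) + fibF (m + 3)"
  "fibF (m + 6) = fibF (m + 5) + fibF (m + 4)"
  by (simp_all add: fibF_def eval_nat_numeral)

lemma fibF_mono: "i \<le> j \<Longrightarrow> fibF i \<le> fibF j"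
  by (simp add: fibF_def fib_mono)

lemma fibF_ge: "i \<le> fibF i"
proof (induction i rule: fib.induct)
  case (3 n)
  then show ?case using fibF_pos[of n] by (simp add: fibF_simps del: fibF_pos)
qed (simp_all add: fibF_simps)

lemma fibF_between:
  assumes "fibF i < fibF j" "fibF j < fibF (Suc i)"
  shows False
  using assms fibF_mono[of j i] fibF_mono[of "Suc i" j] by (cases "j \<le> i") auto

lemma fibF_interval_unique:
  assumes "fibF i < n" "n < fibF (Suc i)" "fibF j < n" "n < fibF (Suc j)"
  shows "i = j"
  using assms fibF_mono[of "Suc i" j] fibF_mono[of "Suc j" i]
  by (cases i j rule: linorder_cases) auto

section \<open>Prefixes of the infinite word and their lengths\<close>

lemma length_fword [simp]: "length (fword i) = fibF i"
  by (induction i rule: fword.induct) (simp_all add: fibF_simps)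

lemma prefix_fword: "1 \<le> i \<Longrightarrow> i \<le> j \<Longrightarrow> prefix (fword i) (fword j)"
proof (induction j)
  case (Suc j)
  show ?case
  proof (cases "i = Suc j")
    case False
    with Suc have "prefix (fword i) (fword j)" "prefix (fword j) (fword (Suc j))"
      by (cases j; simp)+
    then show ?thesis using prefix_order.trans by blast
  qed simp
qed simp

text \<open>The index \<open>Suc n\<close> avoids the exceptional \<open>fword 0\<close>, and
  \<open>fibF_ge\<close> makes that word long enough.\<close>

definition wpre :: "nat \<Rightarrow> letter list" where
  "wpre n = take n (fword (Suc n))"

lemma length_wpre [simp]: "length (wpre n) = n"
  using fibF_ge[of "Suc n"] by (simp add: wpre_def)

text \<open>Both words are prefixes of one later Fibonacci word, so cutting them at the same length
  gives the same result.\<close>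

lemma take_fword:
  assumes "1 \<le> i" "n \<le> fibF i"
  shows "take n (fword i) = wpre n"
proof -
  let ?j = "max i (Suc n)"
  have eq: "take n (fword l) = take n (fword ?j)" if "1 \<le> l" "l \<le> ?j" "n \<le> fibF l" for l
    using prefix_fword[OF that(1,2)] that(3) by (auto simp: prefix_def)
  have "n \<le> fibF (Suc n)" using fibF_ge[of "Suc n"] by simp
  then show ?thesis using eq[of i] eq[of "Suc n"] assms by (simp add: wpre_def)
qed

lemma fword_eq_wpre: "1 \<le> i \<Longrightarrow> fword i = wpre (fibF i)"
  using take_fword[of i "fibF i"] by simp

lemma winf_prefix_wpre [simp]: "winf_prefix (wpre n)"
  unfolding winf_prefix_def wpre_def using take_is_prefix[of n "fword (Suc n)"] by fastforce

lemma winf_prefixE: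
  assumes "winf_prefix v"
  obtains n where "v = wpre n"
proof -
  obtain i where i: "1 \<le> i" "prefix v (fword i)" using assms by (auto simp: winf_prefix_def)
  then have "v = take (length v) (fword i)" "length v \<le> fibF i"
    using prefix_length_le[OF i(2)] by (auto simp: prefix_def)
  then show ?thesis using take_fword[OF i(1)] that by metis
qed

lemma take_wpre: "m \<le> n \<Longrightarrow> take m (wpre n) = wpre m"
  using take_fword[of "Suc n" m] fibF_ge[of "Suc n"] by (simp add: wpre_def min_def)

lemma prefix_wpre_iff [simp]: "prefix (wpre m) (wpre n) \<longleftrightarrow> m \<le> n"
  using prefix_length_le[of "wpre m" "wpre n"] take_is_prefix[of m "wpre n"] take_wpre[of m n]
  by auto

lemma wpre_inject [simp]: "wpre m = wpre n \<longleftrightarrow> m = n"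
  by (metis length_wpre)

lemma strict_prefix_wpre_iff [simp]: "strict_prefix (wpre m) (wpre n) \<longleftrightarrow> m < n"
  by (auto simp: strict_prefix_def)

lemma wpre_0 [simp]: "wpre 0 = []"
  by (simp add: wpre_def)

lemma wpre_in_FW_iff: "wpre n \<in> FW \<longleftrightarrow> n = 0 \<or> (\<exists>i\<ge>1. n = fibF i)"
proof -
  have "wpre n = [] \<longleftrightarrow> n = 0" using wpre_inject[of n 0] by simp
  moreover have "wpre n \<in> fword ` {1..} \<longleftrightarrow> (\<exists>i\<ge>1. n = fibF i)"
    using fword_eq_wpre by (auto simp: image_iff)
  ultimately show ?thesis by (simp add: FW_def)
qed

section \<open>The length of \<open>\<alpha>(v)\<close>\<close>

lemma iota_wpre:
  assumes "3 \<le> i" "fibF i < n" "n < fibF (Suc i)"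
  shows "iota (wpre n) = wpre (n - 2 * fibF (i - 2))"
proof -
  have "wpre n \<notin> FW"
    using assms fibF_between by (auto simp: wpre_in_FW_iff)
  moreover have "(THE i. 3 \<le> i \<and> strict_prefix (fword i) (wpre n) \<and>
      strict_prefix (wpre n) (fword (Suc i))) = i"
  proof (rule the_equality)
    show "3 \<le> i \<and> strict_prefix (fword i) (wpre n) \<and> strict_prefix (wpre n) (fword (Suc i))"
      using assms by (simp add: fword_eq_wpre del: fword.simps)
    fix l assume l: "3 \<le> l \<and> strict_prefix (fword l) (wpre n) \<and>
      strict_prefix (wpre n) (fword (Suc l))"
    then have "1 \<le> l" by simp
    with l have "fibF l < n" "n < fibF (Suc l)" by (simp_all add: fword_eq_wpre del: fword.simps)
    then show "l = i" using fibF_interval_unique assms(2,3) by blast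
  qed
  ultimately show ?thesis by (simp add: iota_def take_wpre)
qed

lemma alpha_fixed:
  assumes "iota v = v"
  shows "alpha v = v"
proof -
  have "(iota ^^ k) v = v" for k by (induction k) (simp_all add: assms)
  then show ?thesis by (auto simp: alpha_def)
qed

text \<open>Dropping the first term of a sequence does not change its eventual value.\<close>

lemma alpha_iota: "alpha (iota v) = alpha v"
proof -
  have "(\<forall>\<^sub>F k in sequentially. (iota ^^ k) (iota v) = u) \<longleftrightarrow>
      (\<forall>\<^sub>F k in sequentially. (iota ^^ k) v = u)" for u
    using eventually_sequentially_Suc[of "\<lambda>k. (iota ^^ k) v = u"] by (simp add: funpow_swap1)
  then show ?thesis by (simp add: alpha_def)
qed

definition len_alpha :: "nat \<Rightarrow> nat" where
  "len_alpha n = length (alpha (wpre n))"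

lemma len_alpha_fibF:
  assumes "1 \<le> i"
  shows "len_alpha (fibF i) = fibF i"
proof -
  have "wpre (fibF i) \<in> FW" using assms by (auto simp: wpre_in_FW_iff)
  then show ?thesis by (simp add: len_alpha_def alpha_fixed iota_def)
qed

text \<open>The hypotheses put the length strictly between two consecutive Fibonacci numbers, where
  \<open>iota\<close> removes exactly \<open>2 * fibF (i + 1)\<close> letters, a step that
  \<open>alpha\<close> does not see.\<close>

lemma len_alpha_reduce:
  assumes "fibF (i + 3) < n + 2 * fibF (i + 1)" "n + 2 * fibF (i + 1) < fibF (i + 4)"
  shows "len_alpha (n + 2 * fibF (i + 1)) = len_alpha n"
proof -
  have i: "Suc (i + 3) = i + 4" "i + 3 - 2 = i + 1" by simp_all
  have "3 \<le> i + 3" by simp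
  from iota_wpre[OF this, unfolded i, OF assms]
  have "iota (wpre (n + 2 * fibF (i + 1))) = wpre n" by (simp only: add_diff_cancel_right')
  then show ?thesis using alpha_iota[of "wpre (n + 2 * fibF (i + 1))"]
    by (simp add: len_alpha_def)
qed

lemma len_alpha_reduce_add_1:
  assumes "fibF (i + 4) < n + 2 * fibF (i + 2)" "n + 2 * fibF (i + 2) < fibF (i + 5)"
  shows "len_alpha (n + 2 * fibF (i + 2)) = len_alpha n"
proof -
  have "i + 1 + 1 = i + 2" "i + 1 + 3 = i + 4" "i + 1 + 4 = i + 5" by simp_all
  then show ?thesis using len_alpha_reduce[of "i + 1" n] assms by (simp only:)
qed

lemma len_alpha_reduce_add_2:
  assumes "fibF (i + 5) < n + 2 * fibF (i + 3)" "n + 2 * fibF (i + 3) < fibF (i + 6)"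
  shows "len_alpha (n + 2 * fibF (i + 3)) = len_alpha n"
proof -
  have "i + 1 + 2 = i + 3" "i + 1 + 4 = i + 5" "i + 1 + 5 = i + 6" by simp_all
  then show ?thesis using len_alpha_reduce_add_1[of "i + 1" n] assms by (simp only:)
qed

text \<open>The length is \<open>fibF (i + 2) + 2 * fibF (i + 1)\<close>, so one step of
  \<open>iota\<close> lands on a Fibonacci word and stays there.\<close>

lemma len_alpha_fibF_add: "len_alpha (fibF (i + 3) + fibF (i + 1)) = fibF (i + 2)"
proof -
  note rec = fibF_rec[of i] fibF_pos[of i] fibF_pos[of "i + 1"]
  have "fibF (i + 3) + fibF (i + 1) = fibF (i + 2) + 2 * fibF (i + 1)"
    using rec by linarith
  also have "len_alpha \<dots> = len_alpha (fibF (i + 2))"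
    by (intro len_alpha_reduce) (use rec in linarith)+
  also have "\<dots> = fibF (i + 2)" by (rule len_alpha_fibF) simp
  finally show ?thesis .
qed

text \<open>Above \<open>fibF (m + 1)\<close>, one step of \<open>iota\<close> leads from the
  shifted length back to \<open>n\<close>. Below it, a step leads to \<open>n + 2 * fibF m\<close>,
  which is the claim for \<open>m - 2\<close>. At \<open>n = fibF (m + 1)\<close> both lengths are
  Fibonacci numbers, so both words are fixed; hence the second alternative.\<close>

lemma len_alpha_shift:
  assumes "n < fibF (m + 3) + fibF (m + 1)"
  shows "len_alpha (n + 2 * fibF (m + 2)) = len_alpha n \<or>
    n \<le> len_alpha n \<and> n \<le> len_alpha (n + 2 * fibF (m + 2))"
  using assms
proof (induction m rule: less_induct)
  case (less m)
  note rec = fibF_rec[of m] fibF_pos[of m] fibF_pos[of "m + 1"]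
  consider "n > fibF (m + 1)" | "n = fibF (m + 1)" | "n = 0" | "0 < n" "n < fibF (m + 1)"
    by linarith
  then show ?case
  proof cases
    case 1
    have "len_alpha (n + 2 * fibF (m + 2)) = len_alpha n"
      by (rule len_alpha_reduce_add_1) (use 1 less.prems rec in linarith)+
    then show ?thesis ..
  next
    case 2
    then have "n + 2 * fibF (m + 2) = fibF (m + 4)" using rec by linarith
    moreover have "fibF (m + 1) \<le> fibF (m + 4)" by (rule fibF_mono) simp
    ultimately show ?thesis using 2 len_alpha_fibF[of "m + 1"] len_alpha_fibF[of "m + 4"] by simp
  next
    case 4
    have "n + 2 * fibF (m + 2) = (n + 2 * fibF m) + 2 * fibF (m + 1)" using rec by linarith
    also have "len_alpha \<dots> = len_alpha (n + 2 * fibF m)"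
      by (rule len_alpha_reduce) (use 4 rec in linarith)+
    finally have red: "len_alpha (n + 2 * fibF (m + 2)) = len_alpha (n + 2 * fibF m)" .
    \<comment> \<open>The descent ends at \<open>m = 0\<close>, where no \<open>n\<close> remains,
      or at \<open>m = 1\<close>, where the lengths \<open>n = 1\<close> and
      \<open>n + 2 * fibF m = 3\<close> are both Fibonacci numbers.\<close>
    consider "m = 0" | "m = 1" | p where "m = p + 2"
      by (metis One_nat_def add_2_eq_Suc' not0_implies_Suc)
    then show ?thesis
    proof cases
      case 1
      then show ?thesis using 4 by (simp add: fibF_simps)
    next
      case 2
      then have "n < fibF 2" using 4(2) by (simp add: numeral_2_eq_2)
      then have "n = 1" using 4(1) by (simp add: fibF_2)
      moreover have "fibF m = 1" using 2 by (simp add: fibF_simps)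
      ultimately have "n + 2 * fibF m = fibF 3" by (simp add: fibF_3)
      then have "len_alpha (n + 2 * fibF m) = 3"
        using len_alpha_fibF[of 3] by (simp only: fibF_3 one_le_numeral simp_thms)
      moreover have "len_alpha n = 1"
        using len_alpha_fibF[of 1] \<open>n = 1\<close> by (simp add: fibF_simps)
      ultimately show ?thesis unfolding red using \<open>n = 1\<close> by linarith
    next
      case 3
      have "n < fibF (p + 3) + fibF (p + 1)"
        using 4(2) fibF_rec(2)[of p] 3 by (simp add: numeral_3_eq_3)
      then show ?thesis unfolding red using less.IH[of p] 3 by simp
    qed
  qed simp
qed

text \<open>One step takes both lengths to the same \<open>r\<close>, because
  \<open>fibF (m + 1) + fibF (m + 2) = fibF (m + 3)\<close>.\<close>

lemma len_alpha_shift_high: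
  assumes "fibF (m + 3) + fibF (m + 1) < n" "n < fibF (m + 4)"
  shows "len_alpha (n + 2 * fibF (m + 2)) = len_alpha n"
proof -
  note rec = fibF_rec[of m]
  define r where "r = n - 2 * fibF (m + 1)"
  then have r: "n = r + 2 * fibF (m + 1)"
    using assms(1) rec by linarith
  have "len_alpha n = len_alpha r"
    unfolding r by (intro len_alpha_reduce) (use assms r rec in linarith)+
  moreover have "n + 2 * fibF (m + 2) = r + 2 * fibF (m + 3)"
    using r rec by linarith
  moreover have "len_alpha (r + 2 * fibF (m + 3)) = len_alpha r"
    by (intro len_alpha_reduce_add_2) (use assms r rec fibF_pos[of m] in linarith)+
  ultimately show ?thesis by simp
qed

text \<open>A step of \<open>iota\<close> leads to \<open>fibF (m + 2) + fibF m\<close>. For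
  \<open>m > 0\<close> one more reaches \<open>fibF (m + 1)\<close>; for \<open>m = 0\<close> this
  is already the Fibonacci number 3, hence only a lower bound.\<close>

lemma len_alpha_shift_fibF: "fibF (m + 1) \<le> len_alpha (fibF (m + 4) + 2 * fibF (m + 2))"
proof -
  note rec = fibF_rec[of m]
  have "fibF (m + 4) + 2 * fibF (m + 2) = (fibF (m + 2) + fibF m) + 2 * fibF (m + 3)"
    using rec by linarith
  moreover have "len_alpha ((fibF (m + 2) + fibF m) + 2 * fibF (m + 3))
      = len_alpha (fibF (m + 2) + fibF m)"
    by (intro len_alpha_reduce_add_2) (use rec fibF_pos[of m] in linarith)+
  moreover have "fibF (m + 1) \<le> len_alpha (fibF (m + 2) + fibF m)"
  proof (cases m)
    case 0
    then have "fibF (m + 1) = 1" "fibF (m + 2) + fibF m = fibF 3"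
      by (simp_all add: fibF_2 fibF_3 fibF_simps)
    then show ?thesis using len_alpha_fibF[of 3] by (simp only: fibF_3)
  next
    case (Suc l)
    then have m: "m = l + 1" by simp
    have "l + 1 + 2 = l + 3" "l + 1 + 1 = l + 2" by simp_all
    then show ?thesis unfolding m by (simp only: len_alpha_fibF_add order_refl)
  qed
  ultimately show ?thesis by (simp only:)
qed

section \<open>The regions in terms of lengths\<close>

text \<open>When \<open>q\<close> moves by \<open>(2 * c, c)\<close> and \<open>n\<close> by
  \<open>c\<close>, the conditions of \<open>inA\<close> and \<open>inC\<close> change only in that
  \<open>len_alpha n\<close> becomes \<open>len_alpha (n + c)\<close>.\<close>

definition inA :: "real \<times> real \<Rightarrow> nat \<Rightarrow> bool" where
  "inA q n \<longleftrightarrow> 2 * real n \<le> fst q \<and> real n - real (len_alpha n) \<le> fst q - snd q"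

definition inC :: "real \<times> real \<Rightarrow> nat \<Rightarrow> bool" where
  "inC q n \<longleftrightarrow> fst q \<le> 2 * real n \<and> snd q \<le> real n + real (len_alpha n)"

lemma regA_wpre_iff: "q \<in> regA (wpre n) \<longleftrightarrow> inA q n"
  by (auto simp: regA_def Pv_def inA_def len_alpha_def max_def)

lemma regC_wpre_iff: "q \<in> regC (wpre n) \<longleftrightarrow> inC q n"
  by (auto simp: regC_def Pv_def inC_def len_alpha_def max_def)

lemma maxA_eq:
  assumes "inA q n" "\<And>m. inA q m \<Longrightarrow> m \<le> n"
  shows "maxA q = wpre n"
  unfolding maxA_def
proof (rule the_equality)
  show "winf_prefix (wpre n) \<and> q \<in> regA (wpre n) \<and>
      (\<forall>u'. winf_prefix u' \<and> q \<in> regA u' \<longrightarrow> prefix u' (wpre n))"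
    using assms by (auto simp: regA_wpre_iff elim!: winf_prefixE)
  fix u assume "winf_prefix u \<and> q \<in> regA u \<and>
      (\<forall>u'. winf_prefix u' \<and> q \<in> regA u' \<longrightarrow> prefix u' u)"
  with assms show "u = wpre n"
    by (metis winf_prefixE regA_wpre_iff winf_prefix_wpre prefix_wpre_iff order_antisym)
qed

lemma minC_eq:
  assumes "maxA q = wpre l" "l < n" "inC q n" "\<And>m. l < m \<Longrightarrow> inC q m \<Longrightarrow> n \<le> m"
  shows "minC q = wpre n"
  unfolding minC_def assms(1)
proof (rule the_equality)
  show "winf_prefix (wpre n) \<and> strict_prefix (wpre l) (wpre n) \<and> q \<in> regC (wpre n) \<and>
      (\<forall>w'. winf_prefix w' \<and> strict_prefix (wpre l) w' \<and> q \<in> regC w' \<longrightarrow> prefix (wpre n) w')"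
    using assms by (auto simp: regC_wpre_iff elim!: winf_prefixE)
  fix w assume "winf_prefix w \<and> strict_prefix (wpre l) w \<and> q \<in> regC w \<and>
      (\<forall>w'. winf_prefix w' \<and> strict_prefix (wpre l) w' \<and> q \<in> regC w' \<longrightarrow> prefix w w')"
  with assms(2-) show "w = wpre n"
    by (metis winf_prefixE regC_wpre_iff winf_prefix_wpre prefix_wpre_iff order_antisym
        strict_prefix_wpre_iff)
qed

lemma Phi_translate: "Phi (vector [x + c, y + c, z + c]) $ j = Phi (vector [x, y, z]) $ j + c"
  using exhaust_3[of j] by (auto simp: Phi_def)

text \<open>No length above \<open>N\<close> is a candidate for \<open>u\<close>, and
  \<open>M\<close> is itself a candidate for \<open>w\<close> because \<open>u \<le> N < M\<close>.
  So it suffices to compare the regions up to these bounds.\<close>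

lemma P_translate:
  assumes A: "inA q 0" "\<And>n. n \<le> N \<Longrightarrow> inA q' (n + c) \<longleftrightarrow> inA q n"
      "\<And>n. inA q n \<Longrightarrow> n \<le> N" "\<And>n. inA q' n \<Longrightarrow> n \<le> N + c"
    and C: "N < M" "inC q M" "\<And>n. n \<le> M \<Longrightarrow> inC q' (n + c) \<longleftrightarrow> inC q n"
    and q': "q' = (fst q + 2 * real c, snd q + real c)"
  shows "P q' $ j = P q $ j + real c"
proof -
  obtain u where u: "inA q u" "\<And>n. inA q n \<Longrightarrow> n \<le> u"
    using GreatestI_nat[of "inA q"] Greatest_le_nat[of "inA q"] A(1,3) by metis
  have uN: "u \<le> N" using u A by blast
  have u': "n \<le> u + c" if "inA q' n" for n
  proof (cases "n \<le> c")
    case False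
    then have "inA q' ((n - c) + c)" using that by simp
    then have "inA q (n - c)" using A(2)[of "n - c"] A(4)[OF that] by simp
    then show ?thesis using u(2)[of "n - c"] by simp
  qed simp
  have maxA: "maxA q = wpre u" "maxA q' = wpre (u + c)"
    using u u' A(2)[of u] uN by (auto intro!: maxA_eq)
  define w where "w = (LEAST n. u < n \<and> inC q n)"
  have uM: "u < M \<and> inC q M" using uN C by simp
  have w: "u < w" "inC q w" using LeastI[of "\<lambda>n. u < n \<and> inC q n", OF uM] by (auto simp: w_def)
  have w_le: "w \<le> n" if "u < n" "inC q n" for n
    unfolding w_def using that by (intro Least_le) simp
  have wM: "w \<le> M" using w_le uM by blast
  have w': "w + c \<le> n" if "u + c < n" "inC q' n" for n
  \<comment> \<open>Beyond \<open>M + c\<close> the bound follows from \<open>w \<le> M\<close>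
    alone.\<close>
  proof (cases "n \<le> M + c")
    case True
    then have "inC q (n - c)" using C(3)[of "n - c"] that by simp
    then show ?thesis using w_le[of "n - c"] that by linarith
  qed (use wM in simp)
  have "minC q = wpre w" by (rule minC_eq[OF maxA(1)]) (use w w_le in auto)
  moreover have "minC q' = wpre (w + c)"
    by (rule minC_eq[OF maxA(2)]) (use w w' wM C(3) in auto)
  ultimately show ?thesis
    using maxA q' Phi_translate[of "fst q - u" c "snd q + u - w" w j]
    by (simp add: P_def Let_def algebra_simps)
qed

theorem theorem3p1:
  fixes k :: nat and q1 q2 :: real and j :: 3
  assumes "k \<ge> 4"
    and "0 \<le> q1" and "q1 \<le> 2 * real (fibF (k - 1)) + 2 * real (fibF (k - 3))"
    and "0 \<le> q2" and "q2 \<le> min q1 (2 * real (fibF (k - 1)))"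
  shows "P (q1 + 4 * real (fibF (k - 2)), q2 + 2 * real (fibF (k - 2))) $ j
         = P (q1, q2) $ j + 2 * real (fibF (k - 2))"
proof -
  obtain m where "k = m + 4" using assms(1) by (metis add.commute le_Suc_ex)
  then have km: "k - 1 = m + 3" "k - 2 = m + 2" "k - 3 = m + 1" by simp_all
  define c where "c = 2 * fibF (m + 2)"
  define N where "N = fibF (m + 3) + fibF (m + 1)"
  define M where "M = fibF (m + 4)"
  note rec = fibF_rec[of m]
  have "N < M" using rec by (simp add: N_def M_def)
  let ?q = "(q1, q2)" and ?q' = "(q1 + 2 * real c, q2 + real c)"
  have b: "q1 \<le> 2 * real N" "q2 \<le> q1" "q2 \<le> 2 * real (fibF (m + 3))"
    using assms(3,5) unfolding km N_def by simp_all
  have "N + c = fibF (m + 5)" using rec unfolding N_def c_def by linarith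
  then have lenN: "len_alpha N = fibF (m + 2)" "len_alpha (N + c) = fibF (m + 5)"
    using len_alpha_fibF_add[of m] len_alpha_fibF[of "m + 5"] by (simp_all add: N_def)
  have lenM: "len_alpha M = fibF (m + 4)" "fibF (m + 1) \<le> len_alpha (M + c)"
    using len_alpha_fibF[of "m + 4"] len_alpha_shift_fibF[of m] by (simp_all add: M_def c_def)
  \<comment> \<open>Both \<open>N + fibF (m + 2)\<close> and \<open>M + fibF (m + 1)\<close> equal
    \<open>2 * fibF (m + 3)\<close>, which is the assumed bound on \<open>q2\<close>.\<close>
  have "2 * fibF (m + 3) \<le> N + len_alpha N" "2 * fibF (m + 3) \<le> N + len_alpha (N + c)"
    "2 * fibF (m + 3) \<le> M + len_alpha M" "2 * fibF (m + 3) \<le> M + len_alpha (M + c)"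
    using lenN lenM rec unfolding N_def M_def by linarith+
  from this[THEN of_nat_mono[where 'a = real]] b(3)
  have big: "q2 \<le> real N + real (len_alpha N)" "q2 \<le> real N + real (len_alpha (N + c))"
    "q2 \<le> real M + real (len_alpha M)" "q2 \<le> real M + real (len_alpha (M + c))"
    unfolding of_nat_add of_nat_mult of_nat_numeral by linarith+
  have A: "inA ?q' (n + c) \<longleftrightarrow> inA ?q n" if "n \<le> N" for n
  proof (cases "n = N")
    case True
    \<comment> \<open>Membership at \<open>N\<close> forces \<open>q1 = 2 * real N\<close>, which
      turns the second condition into a bound from \<open>big\<close>.\<close>
    then show ?thesis using b(1) big by (auto simp: inA_def)
  next
    case False
    \<comment> \<open>In the second alternative of \<open>len_alpha_shift\<close>, the second
      condition holds on both sides since \<open>q2 \<le> q1\<close>.\<close>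
    then show ?thesis using that b len_alpha_shift[of n m] by (auto simp: inA_def N_def c_def)
  qed
  have C: "inC ?q' (n + c) \<longleftrightarrow> inC ?q n" if n: "n \<le> M" for n
  proof -
    consider "n < N" | "n = N" | "N < n" "n < M" | "n = M"
      using n by linarith
    then show ?thesis
    proof cases
      case 1
      \<comment> \<open>Here the second alternative suffices because \<open>q2 \<le> q1\<close> and
        the first condition gives \<open>q1 \<le> 2 * real n\<close>.\<close>
      then show ?thesis using b len_alpha_shift[of n m] by (auto simp: inC_def N_def c_def)
    next
      case 2
      then show ?thesis using big by (auto simp: inC_def)
    next
      case 3
      then show ?thesis using len_alpha_shift_high[of m n]
        by (auto simp: inC_def N_def M_def c_def)
    next
      case 4
      then show ?thesis using big by (auto simp: inC_def)
    qed
  qed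
  have "P ?q' $ j = P ?q $ j + real c"
  proof (rule P_translate[where N = N and M = M])
    show "inA ?q 0" using assms(2) b by (simp add: inA_def)
    show "inC ?q M" using b(1) big \<open>N < M\<close> by (auto simp: inC_def)
  qed (use A C b \<open>N < M\<close> in \<open>auto simp: inA_def\<close>)
  then show ?thesis by (simp add: km c_def)
qed

end
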